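(* For all real $r, k > 0$ and all $N \in \mathbb{N}$, there is $\alpha^*$ such that, whenever $\alpha > \alpha^*$, the equation $$\frac{\alpha}{r} - \mathcal{F}_{N,k}(x) = 0$$ has no solution $x \ge 0$.
   Context: For $k>0$ and $N\in\mathbb{N}$, define for real $x \ge 0$ $$\mathcal{F}_{N,k}(x) := kx\left(1-\left(\frac{x}{x+1/k}\right)^{N+1}\right) - (N+1)\left(\frac{x}{x+1/k}\right)^{N+1}.$$ The unknown $x$ is a real number $x\ge 0$ (the equilibrium quartz concentration), and $\alpha>0$, $r>0$ are real constants. (The equation is the one satisfied by the equilibrium value of $x$ in the system $\dot M_0 = r - k_0xM_0-(p_0+q_0)M_0$, $\dot M_i = k_{i-1}xM_{i-1}-k_ixM_i-(p_i+q_i)M_i$ for $i\ge1$, $\dot x = \alpha - x\sum_{i\ge 0} k_iM_i+\sum_{i\ge 0} i q_i M_i$, with $k_i=k$ for all $i$, $p_i=1,\ q_i=0$ for $i\le N$, and $p_i=0,\ q_i=1$ for $i\ge N+1$.) *)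

theory Defs imports Complex_Main begin

definition \<F> :: "nat \<Rightarrow> real \<Rightarrow> real \<Rightarrow> real" where
  "\<F> N k x =
     k * x * (1 - (x / (x + 1 / k)) ^ (N + 1)) - real (N + 1) * (x / (x + 1 / k)) ^ (N + 1)"

end

theory Submission imports Defs begin

text \<open>
  The equation has no root once \<open>\<alpha> / r\<close> exceeds an upper bound of \<open>\<F> N k\<close> on the half-line
  \<open>x \<ge> 0\<close>, so everything rests on such a bound. With \<open>y = k x\<close> the ratio \<open>x / (x + 1 / k)\<close> is
  \<open>1 - 1 / (y + 1)\<close>. By Bernoulli's inequality its \<open>(N + 1)\<close>-st power falls short of \<open>1\<close> by at
  most \<open>(N + 1) / (y + 1)\<close>; this decay compensates the linear growth of the factor \<open>y\<close>.
\<close>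

lemma \<F>_le:
  fixes k x :: real
  assumes "k > 0" and "x \<ge> 0"
  shows "\<F> N k x \<le> real (N + 1)"
proof -
  define y where "y = k * x"
  define t where "t = x / (x + 1 / k)"
  have y: "y \<ge> 0" using assms by (simp add: y_def)
  have pos: "x + 1 / k > 0" using assms by (simp add: add_nonneg_pos)
  have t0: "t \<ge> 0" using assms pos by (simp add: t_def)
  have "k * (x + 1 / k) = y + 1" using assms by (simp add: y_def field_simps)
  moreover have "t = (k * x) / (k * (x + 1 / k))" using assms by (simp add: t_def)
  ultimately have "t = y / (y + 1)" by (simp add: y_def)
  then have t: "t = 1 + - 1 / (y + 1)" using y by (simp add: field_simps)
  have "1 + real (N + 1) * (- 1 / (y + 1)) \<le> t ^ (N + 1)"
    unfolding t by (rule Bernoulli_inequality) (use y in \<open>simp add: field_simps\<close>)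
  then have "1 - t ^ (N + 1) \<le> real (N + 1) / (y + 1)" by simp
  then have "y * (1 - t ^ (N + 1)) \<le> y * (real (N + 1) / (y + 1))"
    using y by (rule mult_left_mono)
  also have "\<dots> \<le> real (N + 1)" using y by (simp add: field_simps)
  finally have "y * (1 - t ^ (N + 1)) \<le> real (N + 1)" .
  moreover have "real (N + 1) * t ^ (N + 1) \<ge> 0" using t0 by simp
  ultimately show ?thesis unfolding \<F>_def t_def y_def by linarith
qed

theorem proposition1:
  fixes r k :: real and N :: nat
  assumes "r > 0" and "k > 0"
  shows "\<exists>\<alpha>' :: real. \<forall>\<alpha> :: real. \<alpha> > 0 \<and> \<alpha> > \<alpha>' \<longrightarrow>
           \<not> (\<exists>x :: real. x \<ge> 0 \<and> \<alpha> / r - \<F> N k x = 0)"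
proof (intro exI allI impI notI)
  fix \<alpha> :: real
  assume \<alpha>: "\<alpha> > 0 \<and> \<alpha> > r * real (N + 1)"
  assume "\<exists>x :: real. x \<ge> 0 \<and> \<alpha> / r - \<F> N k x = 0"
  then obtain x where x: "x \<ge> 0" "\<alpha> / r = \<F> N k x" by auto
  have "\<alpha> / r > real (N + 1)"
    using \<alpha> \<open>r > 0\<close> by (simp add: pos_less_divide_eq mult.commute)
  with \<F>_le[OF \<open>k > 0\<close> x(1), of N] x(2) show False by linarith
qed

end
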